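(* If $q$ is a prime power and $d \in \mathbb{N}$, then $h_q(q^d - 1) = d-1 = \lfloor \log_q(q^d-1) \rfloor$.
   Context: For a prime power $q$ and $n \in \mathbb{N}$, let $\sigma:\mathbb{F}_q^n\to\mathbb{F}_q^n$ be the cyclic shift $\sigma(\sum_{i=1}^n x_i e_i)=\sum_{i=1}^n x_{i-1}e_i$ (indices mod $n$), where $e_1,\dots,e_n$ is the standard basis. A subspace $U\le \mathbb{F}_q^n$ is cyclically covering if $\bigcup_{r=0}^{n-1}\sigma^r(U)=\mathbb{F}_q^n$. $h_q(n)$ denotes the maximum possible codimension of a cyclically covering subspace of $\mathbb{F}_q^n$. *)

theory Defs
  imports Complex_Main "HOL-Library.Cardinality" "HOL-Number_Theory.Prime_Powers"
    "Jordan_Normal_Form.VS_Connect"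
begin

(* Coordinates are indexed by 0, ..., n - 1. Adding n - 1 instead of subtracting 1 keeps
   the index arithmetic clear of truncated subtraction on nat. *)
definition cyclic_shift :: "'a vec \<Rightarrow> 'a vec" where
  "cyclic_shift x = vec (dim_vec x) (\<lambda>i. x $ ((i + (dim_vec x - 1)) mod dim_vec x))"

definition cyclically_covering :: "nat \<Rightarrow> 'a::field vec set \<Rightarrow> bool" where
  "cyclically_covering n U \<longleftrightarrow>
     VectorSpace.subspace class_ring U (module_vec TYPE('a) n) \<and>
     (\<Union>r<n. (cyclic_shift ^^ r) ` U) = carrier_vec n"

definition codim :: "nat \<Rightarrow> 'a::field vec set \<Rightarrow> nat" where
  "codim n U = n - vectorspace.dim class_ring ((module_vec TYPE('a) n)\<lparr>carrier := U\<rparr>)"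

(* The field is passed as a type, so that for q = CARD('a) this is the number h_q(n).
   The maximum is over a finite set, which is nonempty for n > 0. *)
definition max_covering_codim :: "'a::field itself \<Rightarrow> nat \<Rightarrow> nat" where
  "max_covering_codim _ n = Max {codim n U | U :: 'a vec set. cyclically_covering n U}"

lemma codims_finite_nonempty:
  assumes "n > 0"
  shows "finite {codim n U | U :: 'a::field vec set. cyclically_covering n U}"
    and "{codim n U | U :: 'a::field vec set. cyclically_covering n U} \<noteq> {}"
proof -
  show "finite {codim n U | U :: 'a vec set. cyclically_covering n U}"
    by (rule finite_subset[of _ "{..n}"], force simp: codim_def, simp)
  have dim: "dim_vec ((cyclic_shift ^^ r) x) = dim_vec x" for r and x :: "'a vec"
  proof (induction r)
    case (Suc r)
    have "dim_vec ((cyclic_shift ^^ Suc r) x) = dim_vec (cyclic_shift ((cyclic_shift ^^ r) x))"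
      by (simp only: funpow.simps o_apply)
    also have "\<dots> = dim_vec ((cyclic_shift ^^ r) x)"
      unfolding cyclic_shift_def by (rule dim_vec)
    finally show ?case using Suc.IH by (rule trans)
  qed (simp only: funpow.simps id_apply)
  have "(cyclic_shift ^^ r) x \<in> carrier_vec n" if "x \<in> carrier_vec n" for r and x :: "'a vec"
    by (rule carrier_vecI, unfold dim, rule carrier_vecD[OF that])
  moreover have "x \<in> (cyclic_shift ^^ 0) ` carrier_vec n" if "x \<in> carrier_vec n" for x :: "'a vec"
    using that by simp
  ultimately have "(\<Union>r<n. (cyclic_shift ^^ r) ` carrier_vec n) = (carrier_vec n :: 'a vec set)"
    using assms by blast
  moreover have "submodule class_ring (carrier_vec n) (module_vec TYPE('a) n)"
    by (rule submodule.intro[OF vec_module]) (simp_all add: module_vec_simps)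
  then have "VectorSpace.subspace class_ring (carrier_vec n) (module_vec TYPE('a) n)"
    by (rule subspace.intro[OF vec_vs])
  ultimately have "cyclically_covering n (carrier_vec n :: 'a vec set)"
    by (simp add: cyclically_covering_def)
  then show "{codim n U | U :: 'a vec set. cyclically_covering n U} \<noteq> {}" by blast
qed

end

(* Lower bound: let \<alpha> generate the multiplicative group of the field with q^d elements, inside
   the algebraic closure of F_q. The linear map x \<mapsto> \<Sum> x_i \<alpha>^i turns the cyclic shift of
   F_q^n, n = q^d - 1, into multiplication by \<alpha>, and every nonzero field element is a power of
   \<alpha>. Hence the preimage U of the line F_q \<cdot> 1 covers, and it has codimension d - 1.
   Upper bound: n images of a subspace of codimension c cover only if q^c \<le> n < q^d.
   Dimensions are read off from cardinalities throughout. *)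
theory Submission
  imports Defs "HOL-Algebra.Algebraic_Closure_Type" "HOL-Algebra.Multiplicative_Group"
    "HOL-Number_Theory.Residues"
begin

no_notation Formal_Power_Series.fps_nth (infixl "$" 75)
hide_const (open) Divisibility.prime

section \<open>Arithmetic of q ^ d - 1\<close>

lemma primepow_power_gt_one: "primepow q \<Longrightarrow> d \<ge> 1 \<Longrightarrow> q ^ d > (1::nat)"
  using primepow_gt_Suc_0[of q] by (intro one_less_power) auto

text \<open>The number q ^ d - 1 lies in the half-open interval from q ^ (d - 1) to q ^ d, on which
  the floor of the logarithm is constant. The lower end needs only that q ^ (d - 1) is strictly
  below q ^ d.\<close>

lemma floor_log_power_minus_one:
  assumes "q > 1" "d \<ge> 1"
  shows "\<lfloor>log (real q) (real (q ^ d - 1))\<rfloor> = int d - 1"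
proof -
  have "q ^ (d - 1) < q ^ d" using assms by simp
  moreover have "q ^ d = q ^ (d - 1 + 1)" using assms(2) by simp
  ultimately have "q ^ (d - 1) \<le> q ^ d - 1" "q ^ d - 1 < q ^ (d - 1 + 1)" by linarith+
  then have "\<lfloor>log (real q) (real (q ^ d - 1))\<rfloor> = int (d - 1)"
    using assms(1) by (intro floor_log_nat_eq_if) simp_all
  then show ?thesis using assms(2) by simp
qed

section \<open>Finite vector spaces and the upper bound\<close>

text \<open>Coordinates with respect to a finite basis: linear combination is a bijection from the
  coefficient functions on the basis to the space. Extensional functions make the coefficients
  unique and countable.\<close>

lemma vectorspace_card_eq_power_dim:
  assumes "vectorspace K V" and "vectorspace.fin_dim K V" and "finite (carrier K)"
  shows "finite (carrier V)" and "card (carrier V) = card (carrier K) ^ vectorspace.dim K V"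
proof -
  interpret vectorspace K V by (rule assms(1))
  from finite_basis_exists[OF assms(2)] obtain B where B: "finite B" "basis B" by blast
  then have sub: "B \<subseteq> carrier V" by (simp add: basis_def)
  have *: "\<exists>!a. a \<in> B \<rightarrow>\<^sub>E carrier K \<and> lincomb a B = v" if "v \<in> carrier V" for v
    using basis_criterion[OF B(1) sub] B(2) that by blast
  have closed: "lincomb a B \<in> carrier V" if "a \<in> B \<rightarrow>\<^sub>E carrier K" for a
    using that sub by (intro lincomb_closed) auto
  have "bij_betw (\<lambda>a. lincomb a B) (B \<rightarrow>\<^sub>E carrier K) (carrier V)"
    unfolding bij_betw_def
  proof
    show "inj_on (\<lambda>a. lincomb a B) (B \<rightarrow>\<^sub>E carrier K)"
      using * closed by (intro inj_onI) metis
    show "(\<lambda>a. lincomb a B) ` (B \<rightarrow>\<^sub>E carrier K) = carrier V"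
      using * closed by (auto simp: image_iff) metis
  qed
  moreover have "finite (B \<rightarrow>\<^sub>E carrier K)"
    using B(1) assms(3) by (simp add: finite_PiE)
  moreover have "card (B \<rightarrow>\<^sub>E carrier K) = card (carrier K) ^ dim"
    using card_funcsetE[OF B(1)] dim_basis[OF B] by simp
  ultimately show "finite (carrier V)" "card (carrier V) = card (carrier K) ^ dim"
    by (auto dest: bij_betw_finite bij_betw_same_card)
qed

lemma
  shows finite_carrier_vec: "finite (carrier_vec n :: 'a::{field,finite} vec set)"
    and card_carrier_vec: "card (carrier_vec n :: 'a::{field,finite} vec set) = CARD('a) ^ n"
proof -
  have "vectorspace class_ring (module_vec TYPE('a) n)" by (rule vec_vs)
  from vectorspace_card_eq_power_dim[OF this vec_space.fin_dim]
  show "finite (carrier_vec n :: 'a vec set)" "card (carrier_vec n :: 'a vec set) = CARD('a) ^ n"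
    by (simp_all add: vec_space.dim_is_n module_vec_simps)
qed

lemma card_subspace:
  fixes U :: "'a::{field,finite} vec set"
  assumes "VectorSpace.subspace class_ring U (module_vec TYPE('a) n)"
  shows "card U = CARD('a) ^ vectorspace.dim class_ring ((module_vec TYPE('a) n)\<lparr>carrier := U\<rparr>)"
proof -
  let ?W = "(module_vec TYPE('a) n)\<lparr>carrier := U\<rparr>"
  have W: "vectorspace class_ring ?W"
    by (rule vectorspace.subspace_is_vs[OF vec_vs assms])
  then have mod: "Module.module class_ring ?W" by (rule vectorspace.axioms(1))
  have "U \<subseteq> carrier_vec n"
    using submodule.subset[OF subspace.submod[OF assms]] by (simp add: module_vec_simps)
  then have fin: "finite U" using finite_subset finite_carrier_vec by blast
  \<comment> \<open>The finite set \<open>U\<close> is its own generating set, so finite dimension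
    comes without choosing a basis.\<close>
  have "LinearCombinations.module.span class_ring ?W U = U"
    using LinearCombinations.module.in_own_span[OF mod, of U]
      LinearCombinations.module.span_is_subset2[OF mod, of U] by auto
  then have "vectorspace.fin_dim class_ring ?W"
    unfolding vectorspace.fin_dim_def[OF W] using fin by (intro exI[of _ U]) simp
  from vectorspace_card_eq_power_dim(2)[OF W this] show ?thesis by simp
qed

text \<open>Counting: n images with at most \<open>card U\<close> points each must account for all
  vectors, and \<open>card U\<close> is a power of the field size that cancels.\<close>

lemma power_codim_le:
  fixes U :: "'a::{field,finite} vec set"
  assumes "cyclically_covering n U"
  shows "CARD('a) ^ codim n U \<le> n"
proof -
  let ?W = "(module_vec TYPE('a) n)\<lparr>carrier := U\<rparr>"
  have sub: "VectorSpace.subspace class_ring U (module_vec TYPE('a) n)"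
    and cov: "(\<Union>r<n. (cyclic_shift ^^ r) ` U) = carrier_vec n"
    using assms by (auto simp: cyclically_covering_def)
  have U: "U \<subseteq> carrier_vec n"
    using submodule.subset[OF subspace.submod[OF sub]] by (simp add: module_vec_simps)
  then have fin: "finite U" using finite_subset finite_carrier_vec by blast
  \<comment> \<open>With 0 and 1 distinct, powers of the field size can be compared by exponent. The
    resulting bound on the dimension makes the truncated subtraction in \<open>codim\<close>
    exact.\<close>
  have q: "CARD('a) \<ge> 2" using card_mono[of UNIV "{0, 1 :: 'a}"] by simp
  have "CARD('a) ^ vectorspace.dim class_ring ?W \<le> CARD('a) ^ n"
    using card_mono[OF finite_carrier_vec U] unfolding card_subspace[OF sub] card_carrier_vec .
  then have le: "vectorspace.dim class_ring ?W \<le> n" using q by simp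
  have "CARD('a) ^ n = card (\<Union>r<n. (cyclic_shift ^^ r) ` U)"
    unfolding cov card_carrier_vec ..
  also have "\<dots> \<le> (\<Sum>r<n. card ((cyclic_shift ^^ r) ` U))"
    by (rule card_UN_le) simp
  also have "\<dots> \<le> (\<Sum>r<n. card U)"
    by (intro sum_mono card_image_le fin)
  also have "\<dots> = n * CARD('a) ^ vectorspace.dim class_ring ?W"
    using card_subspace[OF sub] by simp
  finally have "CARD('a) ^ codim n U * CARD('a) ^ vectorspace.dim class_ring ?W
      \<le> n * CARD('a) ^ vectorspace.dim class_ring ?W"
    using le by (simp add: codim_def flip: power_add)
  then show ?thesis by simp
qed

section \<open>Primitive elements of finite fields\<close>

text \<open>Over an algebraically closed field \<open>p\<close> splits into linear factors. A factor
  occurring twice would make its root a root of the derivative too, so the multiset \<open>A\<close>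
  of roots is a set.\<close>

lemma card_roots_eq_degree:
  fixes p :: "'a::alg_closed_field poly"
  assumes "p \<noteq> 0" and sep: "\<And>x. poly p x = 0 \<Longrightarrow> poly (pderiv p) x \<noteq> 0"
  shows "card {x. poly p x = 0} = Polynomial.degree p"
proof -
  obtain A where A: "size A = Polynomial.degree p" "p = Polynomial.smult (Polynomial.lead_coeff p) (\<Prod>x\<in>#A. [:-x, 1:])"
    using alg_closed_imp_factorization[OF assms(1)] by blast
  have poly_p: "poly p x = Polynomial.lead_coeff p * (\<Prod>y\<in>#A. x - y)" for x
    by (subst A(2)) (simp add: poly_prod_mset image_mset.compositionality o_def)
  have roots: "{x. poly p x = 0} = set_mset A"
    using assms(1) by (auto simp: poly_p prod_mset_zero_iff)
  have "count A x = 1" if x: "x \<in># A" for x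
  proof (rule ccontr)
    assume "count A x \<noteq> 1"
    obtain B where B: "A = add_mset x B" using multi_member_split[OF x] by blast
    with \<open>count A x \<noteq> 1\<close> have "x \<in># B" by (auto simp: not_in_iff)
    then obtain C where "A = add_mset x (add_mset x C)"
      using B multi_member_split by metis
    then have "p = [:-x, 1:] * ([:-x, 1:] * Polynomial.smult (Polynomial.lead_coeff p) (\<Prod>x\<in>#C. [:-x, 1:]))"
      using A(2) by simp
    then obtain r where "p = [:-x, 1:] * ([:-x, 1:] * r)" by blast
    then have "poly p x = 0" "poly (pderiv p) x = 0" by (simp_all add: pderiv_mult pderiv_pCons del: mult_pCons_left)
    with sep show False by blast
  qed
  then have "size A = card (set_mset A)" by (simp add: size_multiset_overloaded_eq)
  with A(1) roots show ?thesis by simp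
qed

text \<open>Lagrange's theorem in the group of units gives exponent \<open>CARD('a) - 1\<close> for
  nonzero \<open>x\<close>; one more factor \<open>x\<close> makes the identity hold at 0 as
  well.\<close>

lemma finite_field_power_card:
  fixes x :: "'a::{field,finite}"
  shows "x ^ CARD('a) = x"
proof (cases "x = 0")
  case False
  have units: "Units (class_ring :: 'a ring) = UNIV - {0}"
    using class_field.field_Units by simp
  then have "x [^]\<^bsub>class_ring\<^esub> card (Units (class_ring :: 'a ring)) = \<one>\<^bsub>class_ring\<^esub>"
    using False by (intro cring.units_power_order_eq_one[OF class_cring.cring_axioms]) auto
  then have "x ^ (CARD('a) - 1) = 1"
    by (simp add: units class_ring_simps)
  then have "x ^ Suc (CARD('a) - 1) = x" by (simp only: power_Suc mult_1_right)
  moreover have "Suc (CARD('a) - 1) = CARD('a)" by simp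
  ultimately show ?thesis by (simp only:)
qed (simp add: zero_power)

lemma finite_field_power_card_power:
  fixes x :: "'a::{field,finite}"
  shows "x ^ (CARD('a) ^ d) = x"
  by (induction d) (simp_all add: power_mult finite_field_power_card)

lemma of_nat_card_eq_0: "of_nat CARD('a::{field,finite}) = (0 :: 'a)"
  using CHAR_dvd_CARD[where 'a = 'a] by (simp add: of_nat_eq_0_iff_char_dvd)

text \<open>The prime characteristic divides the prime power \<open>CARD('a)\<close>, hence equals
  its base. This form is what makes taking \<open>CARD('a)\<close>-th powers additive.\<close>

lemma primepow_card_eq_CHAR_power:
  assumes "primepow CARD('a::{field,finite})"
  obtains k where "CARD('a) = CHAR('a) ^ k"
proof -
  have "CHAR('a) > 0" using finite_imp_CHAR_pos[where 'a = 'a] by simp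
  then have "prime CHAR('a)" using prime_CHAR_semidom by blast
  obtain p k where pk: "prime p" "CARD('a) = p ^ k"
    using assms by (auto simp: primepow_def)
  then have "CHAR('a) dvd p"
    using CHAR_dvd_CARD[where 'a = 'a] \<open>prime CHAR('a)\<close> prime_dvd_power by metis
  then have "CHAR('a) = p" using pk(1) \<open>prime CHAR('a)\<close> primes_dvd_imp_eq by blast
  then show ?thesis using that pk(2) by blast
qed

text \<open>For a finite field with q elements and d \<ge> 1 this is the field with q ^ d elements,
  realised as the set of roots of X ^ (q ^ d) - X in the algebraic closure. For d = 0 it is the
  whole closure.\<close>

definition frobenius_fixed :: "nat \<Rightarrow> 'a::field alg_closure set" where
  "frobenius_fixed d = {y. y ^ (CARD('a) ^ d) = y}"

lemma to_ac_in_frobenius_fixed: "to_ac (x :: 'a::{field,finite}) \<in> frobenius_fixed d"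
  using finite_field_power_card_power[of x d]
  by (simp add: frobenius_fixed_def flip: to_ac_power)

text \<open>The polynomial X ^ (q ^ d) - X is separable: q vanishes in the field, so the derivative
  is the constant -1 and there are as many roots as the degree.\<close>

lemma card_frobenius_fixed:
  assumes q: "primepow q" "CARD('a::{field,finite}) = q" and d: "d \<ge> 1"
  shows "card (frobenius_fixed d :: 'a alg_closure set) = q ^ d"
proof -
  have N: "q ^ d > 1" by (rule primepow_power_gt_one[OF q(1) d])
  define p :: "'a alg_closure poly" where "p = Polynomial.monom 1 (q ^ d) - Polynomial.monom 1 1"
  have deg: "Polynomial.degree p = q ^ d"
    unfolding p_def diff_conv_add_uminus using N
    by (subst degree_add_eq_left) (auto simp: degree_monom_eq)
  have "of_nat q = to_ac (0 :: 'a)"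
    using of_nat_card_eq_0[where 'a = 'a] q(2) by (simp flip: to_ac_of_nat)
  \<comment> \<open>Here d \<ge> 1 matters, since 0 ^ 0 = 1.\<close>
  then have "of_nat (q ^ d) = (0 :: 'a alg_closure)" using d by simp
  then have "pderiv p = -1"
    by (simp add: p_def pderiv_diff pderiv_monom monom_0 one_pCons power_0_left)
  moreover have "p \<noteq> 0"
  proof
    assume "p = 0"
    then have "q ^ d = 0" using deg by (simp only: degree_0)
    with N show False by linarith
  qed
  ultimately have "card {x. poly p x = 0} = q ^ d"
    using card_roots_eq_degree[of p] deg by simp
  then show ?thesis by (simp add: frobenius_fixed_def p_def poly_monom q(2))
qed

lemma finite_frobenius_fixed:
  assumes q: "primepow q" "CARD('a::{field,finite}) = q" and d: "d \<ge> 1"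
  shows "finite (frobenius_fixed d :: 'a alg_closure set)"
  using primepow_power_gt_one[OF q(1) d] card_frobenius_fixed[OF q d] by (intro card_ge_0_finite) linarith

text \<open>The exponent is the power \<open>k * d\<close> of the characteristic, so raising to it
  is additive by the freshman's dream.\<close>

lemma frobenius_fixed_add:
  assumes q: "primepow CARD('a::{field,finite})"
    and "x \<in> frobenius_fixed d" "y \<in> frobenius_fixed d"
  shows "x + y \<in> (frobenius_fixed d :: 'a alg_closure set)"
proof -
  obtain k where k: "CARD('a) = CHAR('a) ^ k"
    using primepow_card_eq_CHAR_power[OF q] by blast
  have "CHAR('a) > 0" using finite_imp_CHAR_pos[where 'a = 'a] by simp
  then have pr: "prime CHAR('a)" using prime_CHAR_semidom by blast
  have "CHAR('a alg_closure) = CHAR('a)" by simp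
  then show ?thesis
    using assms pr k freshmans_dream'[where 'a = "'a alg_closure" and n = "k * d" and x = x and y = y]
    by (simp add: frobenius_fixed_def power_mult)
qed

lemma frobenius_fixed_mult:
  "x \<in> frobenius_fixed d \<Longrightarrow> y \<in> frobenius_fixed d \<Longrightarrow> x * y \<in> frobenius_fixed d"
  by (simp add: frobenius_fixed_def power_mult_distrib)

lemma subfield_frobenius_fixed:
  assumes q: "primepow CARD('a::{field,finite})"
  shows "subfield (frobenius_fixed d :: 'a alg_closure set) class_ring"
proof -
  \<comment> \<open>Negation is multiplication by the image of -1, which avoids a case distinction
    on the parity of the exponent.\<close>
  have neg: "- x \<in> frobenius_fixed d" if "x \<in> frobenius_fixed d" for x :: "'a alg_closure"
    using frobenius_fixed_mult[OF to_ac_in_frobenius_fixed[of "-1"] that] by simp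
  have "subring (frobenius_fixed d :: 'a alg_closure set) class_ring"
    using frobenius_fixed_add[OF q] frobenius_fixed_mult neg to_ac_in_frobenius_fixed[of 1]
    by (intro ring.subringI[OF class_ring.ring_axioms]) (auto simp: class_ring_simps)
  then show ?thesis
    by (rule field.subfieldI'[OF class_field]) (auto simp: frobenius_fixed_def power_inverse class_ring_simps)
qed

text \<open>The multiplicative group of a finite field is cyclic. Since a generator satisfies
  \<alpha> ^ (q ^ d - 1) = 1, exponents can be reduced modulo q ^ d - 1, which bounds
  \<open>k\<close>.\<close>

lemma primitive_element_exists:
  assumes q: "primepow q" "CARD('a::{field,finite}) = q" and d: "d \<ge> 1"
  obtains \<alpha> :: "'a::{field,finite} alg_closure" where "\<alpha> \<in> frobenius_fixed d" "\<alpha> ^ (q ^ d - 1) = 1"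
    "\<And>y. y \<in> frobenius_fixed d \<Longrightarrow> y \<noteq> 0 \<Longrightarrow> \<exists>k < q ^ d - 1. y = \<alpha> ^ k"
proof -
  define R :: "'a alg_closure ring" where "R = class_ring\<lparr>carrier := frobenius_fixed d\<rparr>"
  have R: "field R" unfolding R_def
    by (rule ring.subfield_iff(2)[OF class_ring.ring_axioms subfield_frobenius_fixed]) (simp add: q)
  have pow: "x [^]\<^bsub>R\<^esub> k = x ^ k" for x and k :: nat
    by (induction k) (simp_all add: R_def mult.commute)
  obtain \<alpha> where \<alpha>: "\<alpha> \<in> carrier (mult_of R)"
    "carrier (mult_of R) = {\<alpha> [^]\<^bsub>R\<^esub> i | i :: nat. i \<in> UNIV}"
    using field.finite_field_mult_group_has_gen[OF R] finite_frobenius_fixed[OF q d] by (auto simp: R_def)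
  have \<alpha>0: "\<alpha> \<in> frobenius_fixed d" "\<alpha> \<noteq> 0" using \<alpha>(1) by (auto simp: R_def)
  have N: "q ^ d > 1" by (rule primepow_power_gt_one[OF q(1) d])
  have "Suc (q ^ d - 1) = q ^ d" using N by simp
  then have "\<alpha> ^ Suc (q ^ d - 1) = \<alpha>"
    using \<alpha>0(1) q(2) by (simp only: frobenius_fixed_def mem_Collect_eq)
  then have "\<alpha> * \<alpha> ^ (q ^ d - 1) = \<alpha> * 1" by (simp only: power_Suc mult_1_right)
  then have one: "\<alpha> ^ (q ^ d - 1) = 1" using mult_left_cancel[OF \<alpha>0(2)] by blast
  show ?thesis
  proof (rule that[OF \<alpha>0(1) one])
    fix y :: "'a alg_closure" assume "y \<in> frobenius_fixed d" "y \<noteq> 0"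
    then have "y \<in> carrier (mult_of R)" by (simp add: R_def)
    then obtain i :: nat where "y = \<alpha> ^ i" unfolding \<alpha>(2) pow by blast
    also have "\<dots> = \<alpha> ^ ((q ^ d - 1) * (i div (q ^ d - 1)) + i mod (q ^ d - 1))" by simp
    also have "\<dots> = \<alpha> ^ (i mod (q ^ d - 1))"
      by (simp only: power_add power_mult one power_one mult_1)
    finally show "\<exists>k < q ^ d - 1. y = \<alpha> ^ k" using N
      by (intro exI[of _ "i mod (q ^ d - 1)"]) simp
  qed
qed

section \<open>The cyclic shift\<close>

lemma funpow_cyclic_shift_carrier:
  "x \<in> carrier_vec n \<Longrightarrow> (cyclic_shift ^^ r) x \<in> carrier_vec n"
  by (induction r) (auto simp: cyclic_shift_def)

text \<open>Each shift adds n - 1, that is -1 modulo n, to the index being read.\<close>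

lemma index_funpow_cyclic_shift:
  assumes "x \<in> carrier_vec n" "i < n"
  shows "(cyclic_shift ^^ r) x $ i = x $ ((i + r * (n - 1)) mod n)"
  using assms(2)
proof (induction r arbitrary: i)
  case (Suc r)
  have "(cyclic_shift ^^ r) x \<in> carrier_vec n"
    by (rule funpow_cyclic_shift_carrier[OF assms(1)])
  then have "(cyclic_shift ^^ Suc r) x $ i = (cyclic_shift ^^ r) x $ ((i + (n - 1)) mod n)"
    using Suc.prems by (simp add: cyclic_shift_def)
  also have "\<dots> = x $ (((i + (n - 1)) mod n + r * (n - 1)) mod n)"
    using Suc by simp
  also have "((i + (n - 1)) mod n + r * (n - 1)) mod n = (i + Suc r * (n - 1)) mod n"
    by (simp add: mod_simps add.assoc)
  finally show ?case .
qed simp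

text \<open>After n shifts the displacement n * (n - 1) is a multiple of n.\<close>

lemma funpow_cyclic_shift_period:
  assumes "x \<in> carrier_vec n"
  shows "(cyclic_shift ^^ n) x = x"
  using assms funpow_cyclic_shift_carrier[OF assms, of n]
  by (intro eq_vecI) (auto simp: index_funpow_cyclic_shift[OF assms])

text \<open>The vector is read as the coefficient list of a polynomial, evaluated at \<alpha>. For
  \<alpha> ^ n = 1 this factors through F_q[X] / (X ^ n - 1), where the cyclic shift is
  multiplication by X.\<close>

definition vec_eval :: "'a::field alg_closure \<Rightarrow> 'a vec \<Rightarrow> 'a alg_closure" where
  "vec_eval \<alpha> x = (\<Sum>i<dim_vec x. to_ac (x $ i) * \<alpha> ^ i)"

lemma vec_eval_add:
  "x \<in> carrier_vec n \<Longrightarrow> y \<in> carrier_vec n \<Longrightarrow> vec_eval \<alpha> (x + y) = vec_eval \<alpha> x + vec_eval \<alpha> y"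
  by (auto simp: vec_eval_def sum.distrib ring_distribs)

lemma vec_eval_smult: "vec_eval \<alpha> (c \<cdot>\<^sub>v x) = to_ac c * vec_eval \<alpha> x"
  by (simp add: vec_eval_def sum_distrib_left mult.assoc)

lemma vec_eval_unit_vec: "k < n \<Longrightarrow> vec_eval \<alpha> (unit_vec n k) = \<alpha> ^ k"
  by (simp add: vec_eval_def unit_vec_def if_distrib[of to_ac] if_distrib[of "\<lambda>u. u * _"]
     sum.delta cong: if_cong)

lemma vec_eval_cyclic_shift:
  assumes x: "x \<in> carrier_vec n" and \<alpha>: "\<alpha> ^ n = 1"
  shows "vec_eval \<alpha> (cyclic_shift x) = \<alpha> * vec_eval \<alpha> x"
proof (cases "n = 0")
  case False
  have mod: "\<alpha> ^ (j mod n) = \<alpha> ^ j" for j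
  proof -
    have "\<alpha> ^ j = \<alpha> ^ (n * (j div n) + j mod n)" by simp
    then show ?thesis by (simp only: power_add power_mult \<alpha> power_one mult_1)
  qed
  \<comment> \<open>Successor and predecessor modulo n are mutually inverse on the indices; they are
    the witnesses for reindexing the sum. The exponent that wraps around is harmless by
    \<open>mod\<close>.\<close>
  have "Suc i + (n - 1) = i + n" for i using False by simp
  then have inverse: "Suc ((i + (n - 1)) mod n) mod n = i" "(Suc i mod n + (n - 1)) mod n = i"
    if "i < n" for i
    using that by (simp_all only: mod_Suc_eq mod_add_left_eq mod_add_self2 mod_less flip: add_Suc)
  have "vec_eval \<alpha> (cyclic_shift x) = (\<Sum>i<n. to_ac (x $ ((i + (n - 1)) mod n)) * \<alpha> ^ i)"
    using x by (simp add: vec_eval_def cyclic_shift_def)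
  also have "\<dots> = (\<Sum>j<n. to_ac (x $ j) * \<alpha> ^ (Suc j mod n))"
    by (rule sum.reindex_bij_witness[of _ "\<lambda>j. Suc j mod n" "\<lambda>i. (i + (n - 1)) mod n"])
      (use False in \<open>simp_all only: inverse lessThan_iff, simp_all\<close>)
  also have "\<dots> = \<alpha> * vec_eval \<alpha> x"
    using x by (simp add: mod vec_eval_def sum_distrib_left mult_ac)
  finally show ?thesis .
qed (use x in \<open>simp add: vec_eval_def cyclic_shift_def\<close>)

lemma vec_eval_funpow_cyclic_shift:
  assumes "x \<in> carrier_vec n" "\<alpha> ^ n = 1"
  shows "vec_eval \<alpha> ((cyclic_shift ^^ r) x) = \<alpha> ^ r * vec_eval \<alpha> x"
  by (induction r)
    (simp_all add: vec_eval_cyclic_shift[OF funpow_cyclic_shift_carrier[OF assms(1)] assms(2)])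

section \<open>The value of the maximal codimension\<close>

text \<open>Every fibre over \<open>L\<close> is a translate of the kernel. Applied to both the
  large field and F_q, this replaces rank-nullity.\<close>

lemma card_preimage_vec_eval:
  fixes \<alpha> :: "'a::{field,finite} alg_closure"
  assumes "L \<subseteq> vec_eval \<alpha> ` carrier_vec n"
  shows "card {x \<in> carrier_vec n. vec_eval \<alpha> x \<in> L}
    = card L * card {x \<in> carrier_vec n. vec_eval \<alpha> x = 0}"
proof -
  let ?F = "\<lambda>y. {x \<in> carrier_vec n. vec_eval \<alpha> x = y}"
  have finL: "finite L" using assms finite_carrier_vec finite_surj by blast
  have fibre: "card (?F y) = card (?F 0)" if y: "y \<in> L" for y
  proof -
    obtain s where s: "s \<in> carrier_vec n" "vec_eval \<alpha> s = y" using y assms by blast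
    have "bij_betw (\<lambda>x. x + s) (?F 0) (?F y)"
    \<comment> \<open>The inverse translation is written with the scalar -1, so that additivity and
      homogeneity of \<open>vec_eval\<close> suffice.\<close>
    proof (rule bij_betw_byWitness[where f' = "\<lambda>x. x + (-1) \<cdot>\<^sub>v s"])
      show "\<forall>x\<in>?F 0. x + s + (-1) \<cdot>\<^sub>v s = x" "\<forall>x\<in>?F y. x + (-1) \<cdot>\<^sub>v s + s = x"
        using s(1) by (auto intro!: eq_vecI)
      show "(\<lambda>x. x + s) ` ?F 0 \<subseteq> ?F y" "(\<lambda>x. x + (-1) \<cdot>\<^sub>v s) ` ?F y \<subseteq> ?F 0"
        using s by (auto simp: vec_eval_add[where n = n] vec_eval_smult)
    qed
    then show ?thesis by (simp add: bij_betw_same_card)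
  qed
  have "{x \<in> carrier_vec n. vec_eval \<alpha> x \<in> L} = (\<Union>y\<in>L. ?F y)" by blast
  then have "card {x \<in> carrier_vec n. vec_eval \<alpha> x \<in> L} = (\<Sum>y\<in>L. card (?F y))"
    using finL by (simp add: card_UN_disjoint finite_carrier_vec disjoint_iff)
  also have "\<dots> = card L * card (?F 0)" using fibre by simp
  finally show ?thesis .
qed

lemma cyclically_covering_exists:
  assumes q: "primepow q" "CARD('a::{field,finite}) = q" and d: "d \<ge> 1"
  obtains U :: "'a::{field,finite} vec set"
  where "cyclically_covering (q ^ d - 1) U" "codim (q ^ d - 1) U = d - 1"
proof -
  define n where "n = q ^ d - 1"
  obtain \<alpha> :: "'a alg_closure" where \<alpha>: "\<alpha> \<in> frobenius_fixed d" "\<alpha> ^ n = 1"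
    "\<And>y. y \<in> frobenius_fixed d \<Longrightarrow> y \<noteq> 0 \<Longrightarrow> \<exists>k<n. y = \<alpha> ^ k"
    using primitive_element_exists[OF q d] unfolding n_def by metis
  have N: "q ^ d > 1" by (rule primepow_power_gt_one[OF q(1) d])
  then have n: "n > 0" by (simp add: n_def)
  define V where "V = (carrier_vec n :: 'a vec set)"
  define U where "U = {x \<in> V. vec_eval \<alpha> x \<in> range to_ac}"
  have "\<alpha> ^ k \<in> frobenius_fixed d" for k
    by (induction k)
      (use \<alpha>(1) to_ac_in_frobenius_fixed[of 1] frobenius_fixed_mult in auto)
  then have terms: "to_ac c * \<alpha> ^ k \<in> frobenius_fixed d" for c k
    using frobenius_fixed_mult to_ac_in_frobenius_fixed by blast
  have "(\<Sum>i<m. to_ac (x $ i) * \<alpha> ^ i) \<in> frobenius_fixed d" for m and x :: "'a vec"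
    by (induction m)
      (use to_ac_in_frobenius_fixed[of 0] frobenius_fixed_add[where 'a = 'a] q terms in auto)
  then have eval_in: "vec_eval \<alpha> x \<in> frobenius_fixed d" for x
    unfolding vec_eval_def .
  \<comment> \<open>Surjectivity onto the large field: a nonzero element is \<alpha> ^ k with k < n,
    the value at the k-th unit vector.\<close>
  have "y \<in> vec_eval \<alpha> ` V" if "y \<in> frobenius_fixed d" for y
  proof (cases "y = 0")
    case True
    have "vec_eval \<alpha> (0\<^sub>v n) = 0" by (simp add: vec_eval_def)
    then show ?thesis using True by (intro image_eqI[of _ _ "0\<^sub>v n"]) (simp_all add: V_def)
  next
    case False
    then obtain k where "k < n" "y = \<alpha> ^ k" using \<alpha>(3) \<open>y \<in> frobenius_fixed d\<close> by blast
    then show ?thesis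
      by (intro image_eqI[of _ _ "unit_vec n k"]) (simp_all add: V_def vec_eval_unit_vec)
  qed
  then have img: "vec_eval \<alpha> ` V = frobenius_fixed d" using eval_in by blast
  have sub: "VectorSpace.subspace class_ring U (module_vec TYPE('a) n)"
  proof (rule subspace.intro[OF vec_vs submodule.intro[OF vec_module]])
    have "vec_eval \<alpha> (0\<^sub>v n) \<in> range to_ac" by (simp add: vec_eval_def image_iff exI[of _ 0])
    moreover have "a + b \<in> range to_ac" if "a \<in> range to_ac" "b \<in> range to_ac"
      for a b :: "'a alg_closure" using that by (auto simp flip: to_ac_add)
    moreover have "to_ac c * a \<in> range to_ac" if "a \<in> range to_ac" for a and c :: 'a
      using that by (auto simp flip: to_ac_mult)
    ultimately show "U \<subseteq> carrier (module_vec TYPE('a) n)"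
      "\<zero>\<^bsub>module_vec TYPE('a) n\<^esub> \<in> U"
      "\<And>v w. v \<in> U \<Longrightarrow> w \<in> U \<Longrightarrow> v \<oplus>\<^bsub>module_vec TYPE('a) n\<^esub> w \<in> U"
      "\<And>c v. c \<in> carrier class_ring \<Longrightarrow> v \<in> U \<Longrightarrow> c \<odot>\<^bsub>module_vec TYPE('a) n\<^esub> v \<in> U"
      by (auto simp: module_vec_simps U_def V_def vec_eval_add[where n = n] vec_eval_smult)
  qed
  have "x \<in> (\<Union>r<n. (cyclic_shift ^^ r) ` U)" if x: "x \<in> V" for x
  \<comment> \<open>Kernel vectors already lie in \<open>U\<close>, because 0 belongs to
    F_q.\<close>
  proof (cases "vec_eval \<alpha> x = 0")
    case True
    then have "x \<in> (cyclic_shift ^^ 0) ` U" using x by (auto simp: U_def image_iff exI[of _ 0])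
    then show ?thesis using n by blast
  next
    case False
    then obtain k where k: "k < n" "vec_eval \<alpha> x = \<alpha> ^ k" using \<alpha>(3) eval_in by blast
    \<comment> \<open>Shifting n - k times turns the value \<alpha> ^ k into \<alpha> ^ n = 1, which
      lies in F_q; k further shifts complete the period and return to \<open>x\<close>.\<close>
    let ?u = "(cyclic_shift ^^ (n - k)) x"
    have "vec_eval \<alpha> ?u = to_ac 1"
      using x k \<alpha>(2) by (simp add: V_def vec_eval_funpow_cyclic_shift flip: power_add)
    moreover have "?u \<in> V" using x by (simp add: V_def funpow_cyclic_shift_carrier)
    ultimately have "?u \<in> U" unfolding U_def by blast
    moreover have "(cyclic_shift ^^ k) ?u = x"
      using x k(1) funpow_cyclic_shift_period[of x n] funpow_add[of k "n - k" "cyclic_shift :: 'a vec \<Rightarrow> _"]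
      by (simp add: V_def)
    ultimately show ?thesis using k(1) by (intro UN_I[of k]) (simp_all add: image_eqI[of x _ ?u])
  qed
  moreover have "(cyclic_shift ^^ r) ` U \<subseteq> V" for r
    by (auto simp: U_def V_def funpow_cyclic_shift_carrier)
  ultimately have cov: "cyclically_covering n U"
    using sub by (auto simp: cyclically_covering_def V_def)
  \<comment> \<open>The kernel size \<open>?k\<close> is common to the counts of \<open>V\<close>
    and of \<open>U\<close>, so their ratio is q ^ d / q. Comparing exponents of q then yields the
    codimension.\<close>
  let ?k = "card {x \<in> V. vec_eval \<alpha> x = 0}"
  let ?m = "vectorspace.dim class_ring ((module_vec TYPE('a) n)\<lparr>carrier := U\<rparr>)"
  have "V = {x \<in> V. vec_eval \<alpha> x \<in> frobenius_fixed d}" using eval_in by blast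
  then have "card V = q ^ d * ?k"
    using card_preimage_vec_eval[of "frobenius_fixed d" \<alpha> n] img card_frobenius_fixed[OF q d]
    by (simp add: V_def)
  moreover have "card U = q * ?k"
    using card_preimage_vec_eval[of "range to_ac" \<alpha> n] img to_ac_in_frobenius_fixed[where 'a = 'a]
    by (simp add: U_def V_def card_image[OF inj_to_ac] q(2) image_subset_iff)
  ultimately have "card V = q ^ (d - 1) * card U"
    using d by (cases d) auto
  then have "q ^ n = q ^ (d - 1 + ?m)"
    using card_subspace[OF sub] card_carrier_vec[where 'a = 'a] by (simp add: q(2) V_def power_add)
  then have "n = d - 1 + ?m"
    using primepow_gt_Suc_0[OF q(1)] by (simp add: power_inject_exp)
  then have "codim n U = d - 1" by (simp add: codim_def)
  with cov show ?thesis using that unfolding n_def by blast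
qed

lemma max_covering_codim_eq:
  assumes q: "primepow q" "CARD('a::{field,finite}) = q" and d: "d \<ge> 1"
  shows "max_covering_codim TYPE('a) (q ^ d - 1) = d - 1"
  unfolding max_covering_codim_def
proof (rule Max_eqI)
  let ?n = "q ^ d - 1"
  have N: "q ^ d > 1" by (rule primepow_power_gt_one[OF q(1) d])
  show "finite {codim ?n U | U :: 'a vec set. cyclically_covering ?n U}"
    using N by (intro codims_finite_nonempty) simp
  show "d - 1 \<in> {codim ?n U | U :: 'a vec set. cyclically_covering ?n U}"
  proof -
    obtain U :: "'a vec set" where "cyclically_covering ?n U" "codim ?n U = d - 1"
      using cyclically_covering_exists[OF q d] by blast
    then show ?thesis by force
  qed
  fix c assume "c \<in> {codim ?n U | U :: 'a vec set. cyclically_covering ?n U}"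
  \<comment> \<open>The counting bound gives q ^ c \<le> q ^ d - 1, and the missing 1 makes c < d
    strict.\<close>
  then have "q ^ c \<le> ?n" using power_codim_le q(2) by blast
  then have "q ^ c < q ^ d" using N by linarith
  then have "c < d" using primepow_gt_Suc_0[OF q(1)] by simp
  then show "c \<le> d - 1" by simp
qed

theorem theorem3p1:
  fixes q d :: nat
  assumes "primepow q"
    and "CARD('a::{field,finite}) = q"
    and "d \<ge> 1"
  shows "int (max_covering_codim TYPE('a) (q ^ d - 1)) = int d - 1
    \<and> int d - 1 = \<lfloor>log (real q) (real (q ^ d - 1))\<rfloor>"
  using max_covering_codim_eq[OF assms] floor_log_power_minus_one[of q d]
    primepow_gt_Suc_0[OF assms(1)] assms(3)
  by simp

end
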